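(* Let $d \geq 2$ be an integer, let $$G = \langle a, x \mid a^d = 1,\ [a, x^l a x^{-l}] = 1 \text{ for } l = 1, 2, \ldots \rangle$$ be the wreath product $\mathbb{Z}/d\mathbb{Z} \wr \mathbb{Z}$, and let $k$ be a nonzero commutative ring with unit. If $u, v \in kG$ are such that $u(a-1) = v(x-1)$, then $u$ is a left zerodivisor in $kG$. In particular, $kG$ does not satisfy the Ore condition.
   Context: $kG$ is the group ring of $G$ over $k$. Commutator convention: $[g,h] = g h g^{-1} h^{-1}$. An element $u$ of a ring $R$ is a left zerodivisor if there is $\gamma \in R$ with $\gamma \neq 0$ and $u\gamma = 0$ (so $0$ counts as a left zerodivisor when $R\neq 0$). A ring $R$ satisfies the Ore condition if for any $s,t \in R$ with $s$ a non-zerodivisor, there are $p,q \in R$ with $p$ a non-zerodivisor such that $sq = tp$. An element $s$ is a non-zerodivisor if $sb = 0$ or $bs = 0$ implies $b = 0$. (This is the right Ore condition; for group rings the right and left Ore conditions are equivalent.) *)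

theory Defs
  imports "HOL-Library.Poly_Mapping"
begin

text \<open>
  Groups are types of class \<open>group_add\<close>, which is not assumed commutative: the group operation
  is written \<open>+\<close>, its unit \<open>0\<close> and the inverse \<open>- g\<close>. With this convention the type
  \<open>'g \<Rightarrow>\<^sub>0 'k\<close> of finitely supported functions, with its convolution product, is the group
  ring of \<open>'g\<close> over \<open>'k\<close>, and its unit is \<open>Poly_Mapping.single 0 1\<close>.
\<close>

abbreviation group_ring_of :: "'g::group_add \<Rightarrow> ('g \<Rightarrow>\<^sub>0 'k::comm_ring_1)"
  where "group_ring_of g \<equiv> Poly_Mapping.single g 1"


subsection \<open>Group presentations\<close>

text \<open>The letter \<open>(y, True)\<close> stands for the generator \<open>y\<close>, and \<open>(y, False)\<close> for its inverse.\<close>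

type_synonym 'x word = "('x \<times> bool) list"

definition inv_word :: "'x word \<Rightarrow> 'x word"
  where "inv_word w = rev (map (\<lambda>(y, b). (y, \<not> b)) w)"

definition comm_word :: "'x word \<Rightarrow> 'x word \<Rightarrow> 'x word"
  where "comm_word v w = v @ w @ inv_word v @ inv_word w"

text \<open>
  Equality of words in the group with relators \<open>R\<close>: the least congruence on the monoid of words
  that cancels adjacent inverse letters and makes every relator trivial.
\<close>

inductive word_cong :: "'x word set \<Rightarrow> 'x word \<Rightarrow> 'x word \<Rightarrow> bool" for R
  where
    refl: "word_cong R w w"
  | sym: "word_cong R v w \<Longrightarrow> word_cong R w v"
  | trans: "word_cong R u v \<Longrightarrow> word_cong R v w \<Longrightarrow> word_cong R u w"
  | append: "word_cong R v v' \<Longrightarrow> word_cong R w w' \<Longrightarrow> word_cong R (v @ w) (v' @ w')"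
  | cancel: "word_cong R [(y, b), (y, \<not> b)] []"
  | relator: "r \<in> R \<Longrightarrow> word_cong R r []"

definition eval_word :: "('x \<Rightarrow> 'g::group_add) \<Rightarrow> 'x word \<Rightarrow> 'g"
  where "eval_word \<phi> w = (\<Sum>(y, b)\<leftarrow>w. if b then \<phi> y else - \<phi> y)"

text \<open>
  The group \<open>'g\<close> is presented by the generators \<open>\<phi> y\<close>, where \<open>y\<close> ranges over \<open>'x\<close>, and the
  relators \<open>R\<close>: evaluation of words induces an isomorphism from the group of words modulo
  \<open>word_cong R\<close> onto \<open>'g\<close>.
\<close>

definition has_presentation :: "('x \<Rightarrow> 'g::group_add) \<Rightarrow> 'x word set \<Rightarrow> bool"
  where "has_presentation \<phi> R \<longleftrightarrow>
    surj (eval_word \<phi>) \<and> (\<forall>v w. eval_word \<phi> v = eval_word \<phi> w \<longleftrightarrow> word_cong R v w)"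


subsection \<open>The wreath product of a finite cyclic group with the integers\<close>

datatype wreath_gen = Gen_a | Gen_x

definition conj_word :: "nat \<Rightarrow> wreath_gen word"
  where "conj_word l =
    replicate l (Gen_x, True) @ [(Gen_a, True)] @ inv_word (replicate l (Gen_x, True))"

definition wreath_relators :: "nat \<Rightarrow> wreath_gen word set"
  where "wreath_relators d =
    {replicate d (Gen_a, True)} \<union> {comm_word [(Gen_a, True)] (conj_word l) | l. l \<ge> 1}"

definition wreath_presentation :: "nat \<Rightarrow> 'g::group_add \<Rightarrow> 'g \<Rightarrow> bool"
  where "wreath_presentation d a x \<longleftrightarrow>
    has_presentation (case_wreath_gen a x) (wreath_relators d)"


subsection \<open>Zero divisors and the Ore condition\<close>

definition left_zerodivisor :: "'r::ring_1 \<Rightarrow> bool"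
  where "left_zerodivisor u \<longleftrightarrow> (\<exists>\<gamma>. \<gamma> \<noteq> 0 \<and> u * \<gamma> = 0)"

definition non_zerodivisor :: "'r::ring_1 \<Rightarrow> bool"
  where "non_zerodivisor s \<longleftrightarrow> (\<forall>b. s * b = 0 \<or> b * s = 0 \<longrightarrow> b = 0)"

definition ore_condition :: "'r::ring_1 itself \<Rightarrow> bool"
  where "ore_condition R \<longleftrightarrow>
    (\<forall>s t :: 'r. non_zerodivisor s \<longrightarrow> (\<exists>p q. non_zerodivisor p \<and> s * q = t * p))"

end

theory Submission
  imports Defs "HOL-Number_Theory.Cong"
begin

text \<open>
  The Fox derivative \<open>D\<close> with respect to \<open>a\<close> sends a word in the generators to an element of the
  group ring, with \<open>D (v w) = D v + v D w\<close>, \<open>D a = 1\<close> and \<open>D x = 0\<close>. Words that are equal in the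
  group have the same derivative modulo any left ideal \<open>I\<close> that contains the derivatives of the
  relators, so \<open>D\<close> induces an additive map from the group ring to its quotient by \<open>I\<close>. This
  map sends \<open>u (a - 1)\<close> to the class of \<open>u\<close> and \<open>v (x - 1)\<close> to \<open>0\<close>. Hence
  \<open>u (a - 1) = v (x - 1)\<close> forces \<open>u \<in> I\<close> (\<open>fox_deriv_extends_to_group_ring\<close>).

  Write \<open>a\<^sub>i = x\<^sup>i a x\<^bsup>-i\<^esup>\<close>, and \<open>N g = 1 + g + \<dots> + g\<^bsup>d-1\<^esup>\<close>, so that \<open>(g - 1) N g = 0\<close> whenever
  \<open>g\<^sup>d = 1\<close>. The derivatives of the relators are \<open>N a\<close> and
  \<open>(a - 1) x\<^sup>l - (a\<^sub>l - 1) = x\<^sup>l (a\<^bsub>-l\<^esub> - 1) - (a\<^sub>l - 1)\<close> for \<open>l \<ge> 1\<close>. As the \<open>a\<^sub>i\<close> commute, each of these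
  elements is killed on the right by the product of \<open>a - 1\<close> and finitely many \<open>N a\<^sub>i\<close> with
  \<open>i \<noteq> 0\<close>; and what is killed by such products, once they are long enough, is a left ideal.
  It contains all derivatives of relators, therefore it contains \<open>u\<close>.

  So \<open>u\<close> is a left zerodivisor provided that the products are not zero. They have coefficient
  \<open>-1\<close> at the unit (\<open>annihilator_coeff_and_supp\<close>), because the \<open>a\<^sub>i\<close> are independent elements of
  order \<open>d\<close>. That is read off from the lamplighter picture of the group: every element has a
  position in the integers and a configuration of lamps with states modulo \<open>d\<close>, both of which
  are computed from words and respect the relators.

  The Ore condition concerns right multiples, \<open>s q = t p\<close>. The anti-involution that inverts group
  elements turns it into a statement about left multiples. With \<open>s = x\<^bsup>-1\<^esup> - 1\<close>, which is a
  non-zerodivisor because \<open>x\<close> has infinite order, and \<open>t = a\<^bsup>-1\<^esup> - 1\<close>, the first part shows that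
  \<open>p\<close> is a zerodivisor.
\<close>

section \<open>Calculations in a group ring\<close>

abbreviation coeff :: "('g \<Rightarrow>\<^sub>0 'k::zero) \<Rightarrow> 'g \<Rightarrow> 'k"
  where "coeff \<equiv> Poly_Mapping.lookup"

abbreviation supp :: "('g \<Rightarrow>\<^sub>0 'k::zero) \<Rightarrow> 'g set"
  where "supp \<equiv> Poly_Mapping.keys"

lemma group_ring_induct [case_names single add]:
  fixes u :: "'g \<Rightarrow>\<^sub>0 'k::comm_monoid_add"
  assumes single: "\<And>g c. P (Poly_Mapping.single g c)"
    and add: "\<And>u v. P u \<Longrightarrow> P v \<Longrightarrow> P (u + v)"
  shows "P u"
proof (induction u rule: update_induct)
  case const
  show ?case using single[of undefined 0] by simp
next
  case (update f g c)
  have "Poly_Mapping.update g c f = f + Poly_Mapping.single g c"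
    using update.hyps
    by (intro poly_mapping_eqI) (auto simp: lookup_update lookup_add lookup_single when_def in_keys_iff)
  then show ?case using add[OF update.IH single] by simp
qed

lemma coeff_times_group_ring_of:
  fixes u :: "'g::group_add \<Rightarrow>\<^sub>0 'k::comm_ring_1"
  shows "coeff (u * group_ring_of h) g = coeff u (g - h)"
  by (induction u rule: group_ring_induct)
    (auto simp: mult_single lookup_single when_def lookup_add distrib_right algebra_simps)

lemma coeff_group_ring_of_times:
  fixes u :: "'g::group_add \<Rightarrow>\<^sub>0 'k::comm_ring_1"
  shows "coeff (group_ring_of h * u) g = coeff u (- h + g)"
proof (induction u rule: group_ring_induct)
  case (single k c)
  have "h + k = g \<longleftrightarrow> k = - h + g" by (metis add_minus_cancel minus_add_cancel)
  then show ?case by (simp add: mult_single lookup_single)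
qed (simp add: lookup_add distrib_left)

lemma group_ring_of_power:
  "group_ring_of g ^ m = (group_ring_of (sum_list (replicate m g)) :: 'g::group_add \<Rightarrow>\<^sub>0 'k::comm_ring_1)"
  by (induction m) (simp_all add: mult_single)

lemma coeff_group_ring_of_minus_one:
  assumes "g \<noteq> 0"
  shows "coeff (group_ring_of g - 1 :: 'g::group_add \<Rightarrow>\<^sub>0 'k::comm_ring_1) 0 = - 1"
  using assms by (simp add: lookup_minus lookup_single lookup_one)

text \<open>
  The homomorphism \<open>f\<close> witnesses that \<open>g\<close> has infinite order, so no nonempty finite set is
  invariant under translation by \<open>g\<close>.
\<close>

lemma non_zerodivisor_group_ring_of_minus_one:
  fixes f :: "'g::group_add \<Rightarrow> int"
  assumes f_add: "\<And>g h. f (g + h) = f g + f h" and "f g \<noteq> 0"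
  shows "non_zerodivisor (group_ring_of g - 1 :: 'g \<Rightarrow>\<^sub>0 'k::comm_ring_1)"
proof -
  \<comment> \<open>Rescaled so that translation by \<open>g\<close> increases it.\<close>
  define F where "F h = f h * f g" for h
  have F_add: "F (h + h') = F h + F h'" for h h' by (simp add: F_def f_add algebra_simps)
  have F_pos: "F g > 0" using \<open>f g \<noteq> 0\<close> by (auto simp: F_def zero_less_mult_iff linorder_neq_iff)
  \<comment> \<open>An invariant element has invariant support, which a translation raising \<open>F\<close> forces to be empty.\<close>
  have zero: "b = 0"
    if inv: "\<And>h. h \<in> supp b \<Longrightarrow> \<exists>h'\<in>supp b. F h' = F h + F g" for b :: "'g \<Rightarrow>\<^sub>0 'k"
  proof (rule ccontr)
    assume "b \<noteq> 0"
    then have "Max (F ` supp b) \<in> F ` supp b" by (intro Max_in) auto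
    then obtain h where h: "h \<in> supp b" "F h = Max (F ` supp b)" by auto
    obtain h' where "h' \<in> supp b" "F h' = F h + F g" using inv h by blast
    moreover have "F h' \<le> Max (F ` supp b)" using \<open>h' \<in> supp b\<close> by simp
    ultimately show False using h F_pos by simp
  qed
  show ?thesis
    unfolding non_zerodivisor_def
  proof (intro allI impI)
    fix b :: "'g \<Rightarrow>\<^sub>0 'k"
    assume "(group_ring_of g - 1) * b = 0 \<or> b * (group_ring_of g - 1) = 0"
    then show "b = 0"
    proof
      assume "(group_ring_of g - 1) * b = 0"
      then have "group_ring_of g * b = b" by (simp add: algebra_simps)
      then have "coeff b (g + h) = coeff b h" for h
        using coeff_group_ring_of_times[of g b "g + h"] by (simp flip: add.assoc)
      then show ?thesis
        by (intro zero) (metis F_add add.commute in_keys_iff)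
    next
      assume "b * (group_ring_of g - 1) = 0"
      then have "b * group_ring_of g = b" by (simp add: algebra_simps)
      then have "coeff b (h + g) = coeff b h" for h
        using coeff_times_group_ring_of[of b g "h + g"] by simp
      then show ?thesis
        by (intro zero) (metis F_add in_keys_iff)
    qed
  qed
qed

text \<open>
  An anti-involution, which exchanges right multiples with left multiples.
\<close>

definition star :: "('g::group_add \<Rightarrow>\<^sub>0 'k::comm_ring_1) \<Rightarrow> ('g \<Rightarrow>\<^sub>0 'k)"
  where "star = Poly_Mapping.map_key uminus"

lemma star_single [simp]: "star (Poly_Mapping.single g c) = Poly_Mapping.single (- g) c"
  using map_key_single[of uminus "- g" c] by (simp add: star_def)

lemma star_add: "star (u + v) = star u + star v"
  by (simp add: star_def map_key_plus)

lemma star_zero [simp]: "star 0 = 0"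
  by (simp add: star_def)

lemma star_one [simp]: "star 1 = 1"
  using star_single[of 0 1] by simp

lemma star_diff: "star (u - v) = star u - star v"
  by (metis diff_add_cancel star_add add_diff_cancel_right')

lemma star_star [simp]: "star (star u) = u"
  by (induction u rule: group_ring_induct) (simp_all add: star_add)

lemma star_mult: "star (u * v) = star v * star u"
proof (induction u rule: group_ring_induct)
  case (single g c)
  show ?case
    by (induction v rule: group_ring_induct)
      (simp_all add: mult_single star_add minus_add algebra_simps)
qed (simp add: star_add algebra_simps)

section \<open>Fox derivatives\<close>

definition left_ideal :: "'r::ring_1 set \<Rightarrow> bool"
  where "left_ideal I \<longleftrightarrow>
    0 \<in> I \<and> (\<forall>u\<in>I. \<forall>v\<in>I. u + v \<in> I) \<and> (\<forall>r. \<forall>u\<in>I. r * u \<in> I)"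

lemma left_ideal_add: "left_ideal I \<Longrightarrow> u \<in> I \<Longrightarrow> v \<in> I \<Longrightarrow> u + v \<in> I"
  and left_ideal_mult: "left_ideal I \<Longrightarrow> u \<in> I \<Longrightarrow> r * u \<in> I"
  and left_ideal_zero: "left_ideal I \<Longrightarrow> 0 \<in> I"
  by (auto simp: left_ideal_def)

lemma left_ideal_uminus: "left_ideal I \<Longrightarrow> u \<in> I \<Longrightarrow> - u \<in> I"
  using left_ideal_mult[of I u "- 1"] by simp

lemma left_ideal_diff: "left_ideal I \<Longrightarrow> u \<in> I \<Longrightarrow> v \<in> I \<Longrightarrow> u - v \<in> I"
  using left_ideal_add[of I u "- v"] left_ideal_uminus[of I v] by simp

lemma eval_word_Nil [simp]: "eval_word \<phi> [] = 0"
  and eval_word_Cons [simp]: "eval_word \<phi> ((y, b) # w) = (if b then \<phi> y else - \<phi> y) + eval_word \<phi> w"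
  and eval_word_append [simp]: "eval_word \<phi> (v @ w) = eval_word \<phi> v + eval_word \<phi> w"
  by (simp_all add: eval_word_def)

lemma inv_word_Nil [simp]: "inv_word [] = []"
  and inv_word_Cons [simp]: "inv_word ((y, b) # w) = inv_word w @ [(y, \<not> b)]"
  by (simp_all add: inv_word_def)

lemma eval_word_inv_word [simp]: "eval_word \<phi> (inv_word w) = - eval_word \<phi> w"
  by (induction w) (auto simp: minus_add)

lemma eval_word_replicate [simp]:
  "eval_word \<phi> (replicate n (y, True)) = sum_list (replicate n (\<phi> y))"
  by (induction n) simp_all

lemma has_presentation_relator:
  assumes "has_presentation \<phi> R" "r \<in> R"
  shows "eval_word \<phi> r = 0"
  using assms word_cong.relator[of r R] unfolding has_presentation_def by (metis eval_word_Nil)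

text \<open>
  The derivative is computed in the group ring of the presented group itself, not in that of the
  free group: the coefficients are the values of the prefixes of the word.
\<close>

fun fox_deriv :: "('x \<Rightarrow> 'g::group_add) \<Rightarrow> 'x \<Rightarrow> 'x word \<Rightarrow> ('g \<Rightarrow>\<^sub>0 'k::comm_ring_1)" where
  "fox_deriv \<phi> z [] = 0"
| "fox_deriv \<phi> z ((y, True) # w) = of_bool (y = z) + group_ring_of (\<phi> y) * fox_deriv \<phi> z w"
| "fox_deriv \<phi> z ((y, False) # w) = group_ring_of (- \<phi> y) * (fox_deriv \<phi> z w - of_bool (y = z))"

lemma fox_deriv_append:
  "fox_deriv \<phi> z (v @ w) = fox_deriv \<phi> z v + group_ring_of (eval_word \<phi> v) * fox_deriv \<phi> z w"
  by (induction \<phi> z v rule: fox_deriv.induct)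
    (simp_all add: algebra_simps mult_single flip: mult.assoc)

lemma fox_deriv_inv_word:
  "fox_deriv \<phi> z (inv_word w) = - group_ring_of (- eval_word \<phi> w) * fox_deriv \<phi> z w"
proof (induction \<phi> z w rule: fox_deriv.induct)
  case (2 \<phi> z y w)
  then show ?case
    by (simp add: fox_deriv_append algebra_simps minus_add mult_single flip: mult.assoc)
next
  case (3 \<phi> z y w)
  then show ?case
    by (simp add: fox_deriv_append algebra_simps minus_add mult_single flip: mult.assoc)
qed simp

text \<open>
  In a free group, the derivative of \<open>[v, w]\<close> is \<open>(1 - v w v\<^bsup>-1\<^esup>) D v + (v - [v, w]) D w\<close>. Where the
  commutator is trivial, \<open>v w v\<^bsup>-1\<^esup>\<close> becomes \<open>w\<close>.
\<close>

lemma fox_deriv_comm_word: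
  assumes "eval_word \<phi> v + eval_word \<phi> w = eval_word \<phi> w + eval_word \<phi> v"
  shows "fox_deriv \<phi> z (comm_word v w) =
    (group_ring_of (eval_word \<phi> v) - 1) * fox_deriv \<phi> z w
    - (group_ring_of (eval_word \<phi> w) - 1) * fox_deriv \<phi> z v"
proof -
  let ?v = "eval_word \<phi> v" and ?w = "eval_word \<phi> w"
  have 1: "?v + (?w - ?v) = ?w" using assms by (metis add_diff_cancel diff_add_eq add_diff_eq)
  have 2: "?v + (?w + (- ?v - ?w)) = 0" using 1 by (metis add.assoc diff_conv_add_uminus right_minus)
  show ?thesis
    using 1 2 unfolding comm_word_def fox_deriv_append fox_deriv_inv_word
    by (simp add: algebra_simps mult_single flip: mult.assoc)
qed

lemma fox_deriv_replicate:
  "fox_deriv \<phi> z (replicate n (z, True)) = (\<Sum>m<n. group_ring_of (\<phi> z) ^ m)"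
  by (induction n) (simp_all add: sum.lessThan_Suc_shift sum_distrib_left del: sum.lessThan_Suc)

text \<open>
  The product rule makes the relation \<open>D v - D w \<in> I\<close> between words with equal values a
  congruence. A left ideal is what the product rule needs, as it multiplies \<open>D w\<close> by the value
  of \<open>v\<close> on the left.
\<close>

lemma fox_deriv_word_cong:
  fixes I :: "('g::group_add \<Rightarrow>\<^sub>0 'k::comm_ring_1) set"
  assumes pres: "has_presentation \<phi> R" and I: "left_ideal I"
    and rel: "\<And>r. r \<in> R \<Longrightarrow> fox_deriv \<phi> z r \<in> I"
    and "word_cong R v w"
  shows "fox_deriv \<phi> z v - fox_deriv \<phi> z w \<in> I"
  using \<open>word_cong R v w\<close>
proof (induction rule: word_cong.induct)
  case (refl w)
  then show ?case by (simp add: left_ideal_zero[OF I])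
next
  case (sym v w)
  then show ?case using left_ideal_uminus[OF I sym.IH] by simp
next
  case (trans u v w)
  then show ?case using left_ideal_add[OF I trans.IH] by simp
next
  case (append v v' w w')
  have "eval_word \<phi> v = eval_word \<phi> v'"
    using pres append.hyps unfolding has_presentation_def by blast
  then have eq: "fox_deriv \<phi> z (v @ w) - fox_deriv \<phi> z (v' @ w') =
      (fox_deriv \<phi> z v - fox_deriv \<phi> z v')
      + group_ring_of (eval_word \<phi> v) * (fox_deriv \<phi> z w - fox_deriv \<phi> z w')"
    by (simp add: fox_deriv_append algebra_simps)
  show ?case
    unfolding eq using append.IH by (intro left_ideal_add[OF I] left_ideal_mult[OF I])
next
  case (cancel y b)
  have "fox_deriv \<phi> z [(y, b), (y, \<not> b)] = (0 :: 'g \<Rightarrow>\<^sub>0 'k)"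
    by (cases b) (simp_all add: algebra_simps mult_single)
  then show ?case using left_ideal_zero[OF I] by simp
next
  case (relator r)
  then show ?case using rel by simp
qed

text \<open>
  Scalars \<open>c\<close> of the coefficient ring act as the elements \<open>Poly_Mapping.single 0 c\<close>.
\<close>

definition linear_extension :: "('g \<Rightarrow> ('g \<Rightarrow>\<^sub>0 'k)) \<Rightarrow> ('g::group_add \<Rightarrow>\<^sub>0 'k::comm_ring_1) \<Rightarrow> ('g \<Rightarrow>\<^sub>0 'k)"
  where "linear_extension F u = (\<Sum>g\<in>supp u. Poly_Mapping.single 0 (coeff u g) * F g)"

lemma linear_extension_add:
  "linear_extension F (u + v) = linear_extension F u + linear_extension F v"
  unfolding linear_extension_def
  by (rule setsum_keys_plus_distrib) (simp_all add: single_add distrib_right)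

lemma linear_extension_single [simp]:
  "linear_extension F (Poly_Mapping.single g c) = Poly_Mapping.single 0 c * F g"
  by (simp add: linear_extension_def)

lemma linear_extension_diff:
  "linear_extension F (u - v) = linear_extension F u - linear_extension F v"
  by (metis diff_add_cancel linear_extension_add add_diff_cancel_right')

text \<open>
  The form in which the presentation is used. On a group element, \<open>T\<close> is the derivative of some
  word for it, well defined modulo \<open>I\<close>; the product rule for \<open>g \<cdot> \<phi> y\<close> then gives
  \<open>T (g (\<phi> y - 1)) \<equiv> g\<close> if \<open>y = z\<close>, and \<open>0\<close> otherwise.
\<close>

lemma fox_deriv_extends_to_group_ring:
  fixes I :: "('g::group_add \<Rightarrow>\<^sub>0 'k::comm_ring_1) set"
  assumes pres: "has_presentation \<phi> R" and I: "left_ideal I"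
    and rel: "\<And>r. r \<in> R \<Longrightarrow> fox_deriv \<phi> z r \<in> I"
  obtains T :: "('g \<Rightarrow>\<^sub>0 'k) \<Rightarrow> ('g \<Rightarrow>\<^sub>0 'k)"
  where "\<And>y u. T (u * (group_ring_of (\<phi> y) - 1)) - u * of_bool (y = z) \<in> I"
proof -
  define W where "W g = (SOME w. eval_word \<phi> w = g)" for g
  have W: "eval_word \<phi> (W g) = g" for g
    unfolding W_def using pres unfolding has_presentation_def by (metis (mono_tags) someI_ex surjD)
  define F :: "'g \<Rightarrow> ('g \<Rightarrow>\<^sub>0 'k)" where "F g = fox_deriv \<phi> z (W g)" for g
  have F: "F (g + \<phi> y) - F g - group_ring_of g * of_bool (y = z) \<in> I" for g y
  proof -
    have "eval_word \<phi> (W (g + \<phi> y)) = eval_word \<phi> (W g @ [(y, True)])"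
      by (simp add: W)
    then have "word_cong R (W (g + \<phi> y)) (W g @ [(y, True)])"
      using pres unfolding has_presentation_def by blast
    then have "fox_deriv \<phi> z (W (g + \<phi> y)) - fox_deriv \<phi> z (W g @ [(y, True)]) \<in> I"
      using fox_deriv_word_cong[OF pres I rel] by blast
    then show ?thesis
      by (simp add: F_def fox_deriv_append W algebra_simps)
  qed
  have "linear_extension F (u * (group_ring_of (\<phi> y) - 1)) - u * of_bool (y = z) \<in> I" for y u
  proof (induction u rule: group_ring_induct)
    case (single g c)
    have "linear_extension F (Poly_Mapping.single g c * (group_ring_of (\<phi> y) - 1))
        - Poly_Mapping.single g c * of_bool (y = z)
      = Poly_Mapping.single 0 c * (F (g + \<phi> y) - F g - group_ring_of g * of_bool (y = z))"
      by (simp add: right_diff_distrib linear_extension_diff mult_single flip: mult.assoc)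
    then show ?case using left_ideal_mult[OF I F] by simp
  next
    case (add u v)
    from left_ideal_add[OF I this] show ?case
      by (simp only: distrib_right linear_extension_add add_diff_eq diff_add_eq diff_diff_eq add_ac)
  qed
  then show ?thesis by (rule that)
qed

section \<open>Norm elements\<close>

definition norm_element :: "nat \<Rightarrow> 'g::group_add \<Rightarrow> ('g \<Rightarrow>\<^sub>0 'k::comm_ring_1)"
  where "norm_element n g = (\<Sum>m<n. group_ring_of g ^ m)"

lemma norm_element_commute:
  assumes "u * group_ring_of g = group_ring_of g * u"
  shows "u * norm_element n g = norm_element n g * u"
proof -
  have "u * group_ring_of g ^ m = group_ring_of g ^ m * u" for m
    using assms by (induction m) (simp_all, metis mult.assoc)
  then show ?thesis by (simp add: norm_element_def sum_distrib_left sum_distrib_right)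
qed

lemma minus_one_times_norm_element:
  assumes "sum_list (replicate n g) = 0"
  shows "(group_ring_of g - 1) * norm_element n g = 0"
proof -
  have "(group_ring_of g - 1) * norm_element n g = (\<Sum>m<n. group_ring_of g ^ Suc m - group_ring_of g ^ m)"
    by (simp add: norm_element_def sum_distrib_left algebra_simps sum_subtractf)
  also have "\<dots> = group_ring_of g ^ n - group_ring_of g ^ 0" by (rule sum_lessThan_telescope)
  also have "\<dots> = 0" using assms by (simp add: group_ring_of_power)
  finally show ?thesis .
qed

lemma coeff_times_norm_element:
  "coeff (u * norm_element n g) h = (\<Sum>m<n. coeff u (h - sum_list (replicate m g)))"
  by (simp add: norm_element_def sum_distrib_left lookup_sum group_ring_of_power
      coeff_times_group_ring_of)


section \<open>Integer multiples in a group\<close>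

text \<open>
  The group is written additively, so this is the power \<open>g\<^sup>i\<close> with an integer exponent.
\<close>

definition int_mult :: "int \<Rightarrow> 'g::group_add \<Rightarrow> 'g"
  where "int_mult i g =
    (if i \<ge> 0 then sum_list (replicate (nat i) g) else - sum_list (replicate (nat (- i)) g))"

lemma int_mult_zero [simp]: "int_mult 0 g = 0"
  and int_mult_of_nat: "int_mult (int n) g = sum_list (replicate n g)"
  by (simp_all add: int_mult_def)

lemma int_mult_add_one: "int_mult (i + 1) g = int_mult i g + g"
proof -
  have comm: "sum_list (replicate n g) + g = g + sum_list (replicate n g)" for n
    by (induction n) (simp_all add: add.assoc)
  show ?thesis
  proof (cases "i \<ge> 0")
    case True
    then have "nat (i + 1) = Suc (nat i)" by simp
    then show ?thesis using True by (simp add: int_mult_def comm)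
  next
    case False
    define n where "n = nat (- i - 1)"
    have i: "i = - int n - 1" using False by (simp add: n_def)
    have "int_mult i g = - sum_list (replicate (Suc n) g)" by (simp add: int_mult_def i nat_add_distrib)
    moreover have "int_mult (i + 1) g = - sum_list (replicate n g)" by (simp add: int_mult_def i)
    ultimately show ?thesis by (simp add: minus_add add.assoc)
  qed
qed

lemma int_mult_add: "int_mult (i + j) g = int_mult i g + int_mult j g"
proof (induction j rule: int_induct[where k = 0])
  case (step1 j)
  then show ?case
    using int_mult_add_one[of "i + j" g] int_mult_add_one[of j g] by (simp add: add.assoc)
next
  case (step2 j)
  have "int_mult (i + (j - 1)) g + g = int_mult i g + int_mult (j - 1) g + g"
    using int_mult_add_one[of "i + j - 1" g] int_mult_add_one[of "j - 1" g] step2.IH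
    by (simp add: add.assoc add_diff_eq)
  then show ?case by simp
qed simp

section \<open>Lamplighter coordinates\<close>

text \<open>
  A word is read as instructions to a lamplighter who starts at \<open>0\<close>: the letter \<open>x\<close> is a step to
  the right, and \<open>a\<close> increases the state of the lamp at the current place. Since the recursion
  removes the first letter, a first step shifts the configuration that the rest of the word
  creates.
\<close>

fun position :: "wreath_gen word \<Rightarrow> int" where
  "position [] = 0"
| "position ((Gen_a, b) # w) = position w"
| "position ((Gen_x, b) # w) = (if b then 1 else - 1) + position w"

fun lamps :: "wreath_gen word \<Rightarrow> int \<Rightarrow> int" where
  "lamps [] i = 0"
| "lamps ((Gen_a, b) # w) i = (if i = 0 then if b then 1 else - 1 else 0) + lamps w i"
| "lamps ((Gen_x, b) # w) i = lamps w (i - (if b then 1 else - 1))"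

lemma position_append [simp]: "position (v @ w) = position v + position w"
  by (induction v rule: position.induct) simp_all

lemma lamps_append [simp]: "lamps (v @ w) i = lamps v i + lamps w (i - position v)"
  by (induction v i rule: lamps.induct) (simp_all add: algebra_simps)

lemma position_inv_word [simp]: "position (inv_word w) = - position w"
  by (induction w rule: position.induct) simp_all

lemma lamps_inv_word [simp]: "lamps (inv_word w) i = - lamps w (i + position w)"
  by (induction w arbitrary: i rule: position.induct) (simp_all add: algebra_simps)

lemma position_replicate_a: "position (replicate n (Gen_a, True)) = 0"
  and lamps_replicate_a: "lamps (replicate n (Gen_a, True)) i = (if i = 0 then int n else 0)"
  by (induction n) simp_all

lemma position_conj_word: "position (conj_word l) = 0"
  by (simp add: conj_word_def)

lemma lamps_comm_word:
  assumes "position v = 0" "position w = 0"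
  shows "lamps (comm_word v w) i = 0"
  using assms by (simp add: comm_word_def)

text \<open>
  The commutation relators have position \<open>0\<close> and leave every lamp as it was; the relator
  \<open>a\<^sup>d\<close> adds \<open>d\<close> to a single lamp. Hence the states are well defined modulo \<open>d\<close>.
\<close>

lemma lamplighter_invariants:
  assumes "word_cong (wreath_relators d) v w"
  shows "position v = position w \<and> (\<forall>i. [lamps v i = lamps w i] (mod int d))"
  using assms
proof (induction rule: word_cong.induct)
  case (append v v' w w')
  then show ?case by (simp add: cong_add)
next
  case (cancel y b)
  then show ?case by (cases y; cases b) simp_all
next
  case (relator r)
  then show ?case
    by (auto simp: wreath_relators_def position_replicate_a lamps_replicate_a cong_def
        lamps_comm_word position_conj_word) (simp add: comm_word_def position_conj_word)
qed (auto intro: cong_sym cong_trans)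

locale lamplighter =
  fixes d :: nat and a x :: "'g::group_add"
  assumes d_ge_2: "d \<ge> 2" and presentation: "wreath_presentation d a x"
begin

abbreviation eval :: "wreath_gen word \<Rightarrow> 'g"
  where "eval \<equiv> eval_word (case_wreath_gen a x)"

lemma presented: "has_presentation (case_wreath_gen a x) (wreath_relators d)"
  using presentation by (simp add: wreath_presentation_def)

definition pos :: "'g \<Rightarrow> int"
  where "pos g = position (SOME w. eval w = g)"

definition lamp_state :: "'g \<Rightarrow> int \<Rightarrow> int"
  where "lamp_state g i = lamps (SOME w. eval w = g) i mod int d"

lemma exists_word: obtains w where "eval w = g"
  using presented unfolding has_presentation_def by (metis surjD)

lemma pos_eval: "pos (eval w) = position w"
  and lamp_state_eval: "lamp_state (eval w) i = lamps w i mod int d"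
proof -
  have "eval (SOME v. eval v = eval w) = eval w" by (rule someI) (rule HOL.refl)
  then have "word_cong (wreath_relators d) (SOME v. eval v = eval w) w"
    using presented unfolding has_presentation_def by blast
  from lamplighter_invariants[OF this]
  show "pos (eval w) = position w" "lamp_state (eval w) i = lamps w i mod int d"
    by (simp_all add: pos_def lamp_state_def cong_def)
qed

lemma pos_add: "pos (g + h) = pos g + pos h"
  and lamp_state_add: "lamp_state (g + h) i = (lamp_state g i + lamp_state h (i - pos g)) mod int d"
proof -
  obtain v w where g: "g = eval v" and h: "h = eval w" by (metis exists_word)
  have gh: "g + h = eval (v @ w)" by (simp add: g h)
  show "pos (g + h) = pos g + pos h"
    unfolding gh unfolding g h pos_eval by simp
  show "lamp_state (g + h) i = (lamp_state g i + lamp_state h (i - pos g)) mod int d"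
    unfolding gh unfolding g h pos_eval lamp_state_eval by (simp add: mod_simps)
qed

lemma pos_zero [simp]: "pos 0 = 0"
  and lamp_state_zero [simp]: "lamp_state 0 i = 0"
  using pos_eval[of "[]"] lamp_state_eval[of "[]"] by simp_all

lemma lamp_state_mod [simp]: "lamp_state g i mod int d = lamp_state g i"
  by (simp add: lamp_state_def)

lemma pos_minus: "pos (- g) = - pos g"
  using pos_add[of "- g" g] by simp

lemma pos_a: "pos a = 0" and lamp_state_a: "lamp_state a i = of_bool (i = 0)"
  and pos_x: "pos x = 1" and lamp_state_x: "lamp_state x i = 0"
  using pos_eval[of "[(Gen_a, True)]"] lamp_state_eval[of "[(Gen_a, True)]"]
    pos_eval[of "[(Gen_x, True)]"] lamp_state_eval[of "[(Gen_x, True)]"] d_ge_2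
  by simp_all

lemma pos_int_mult_x: "pos (int_mult i x) = i"
  and lamp_state_int_mult_x: "lamp_state (int_mult i x) j = 0"
proof -
  have "pos (int_mult i x) = i \<and> (\<forall>j. lamp_state (int_mult i x) j = 0)"
  proof (induction i rule: int_induct[where k = 0])
    case (step1 i)
    then show ?case by (simp add: int_mult_add_one pos_add lamp_state_add pos_x lamp_state_x)
  next
    case (step2 i)
    have eq: "int_mult i x = int_mult (i - 1) x + x" using int_mult_add_one[of "i - 1" x] by simp
    from step2 show ?case
      unfolding eq by (auto simp: pos_add lamp_state_add pos_x lamp_state_x)
  qed simp
  then show "pos (int_mult i x) = i" "lamp_state (int_mult i x) j = 0" by auto
qed

text \<open>
  The conjugate \<open>x\<^sup>i a x\<^bsup>-i\<^esup>\<close>, which acts on the lamp at \<open>i\<close> alone.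
\<close>

definition lamp :: "int \<Rightarrow> 'g"
  where "lamp i = int_mult i x + a - int_mult i x"

lemma lamp_zero: "lamp 0 = a"
  by (simp add: lamp_def)

lemma int_mult_x_plus_lamp: "int_mult i x + lamp j = lamp (i + j) + int_mult i x"
  by (simp add: lamp_def int_mult_add minus_add diff_conv_add_uminus add.assoc
      del: add_uminus_conv_diff)

lemma pos_lamp: "pos (lamp i) = 0"
  using int_mult_x_plus_lamp[of i 0] pos_add[of "int_mult i x" a] pos_add[of "lamp i" "int_mult i x"]
  by (simp add: lamp_zero pos_a)

lemma lamp_state_lamp: "lamp_state (lamp i) j = of_bool (j = i)"
  using int_mult_x_plus_lamp[of i 0] lamp_state_add[of "int_mult i x" a j]
    lamp_state_add[of "lamp i" "int_mult i x" j] d_ge_2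
  by (auto simp add: lamp_zero lamp_state_a pos_lamp lamp_state_int_mult_x pos_int_mult_x)

lemma lamp_state_add_lamps:
  assumes "pos g = 0"
  shows "lamp_state (g + sum_list (replicate m (lamp i))) j
    = (lamp_state g j + int m * of_bool (j = i)) mod int d"
    and "pos (g + sum_list (replicate m (lamp i))) = 0"
proof -
  have "pos (sum_list (replicate m (lamp i))) = 0
    \<and> lamp_state (sum_list (replicate m (lamp i))) j = int m * of_bool (j = i) mod int d"
    by (induction m) (simp_all add: pos_add lamp_state_add pos_lamp lamp_state_lamp mod_simps algebra_simps)
  then show "lamp_state (g + sum_list (replicate m (lamp i))) j
    = (lamp_state g j + int m * of_bool (j = i)) mod int d"
    and "pos (g + sum_list (replicate m (lamp i))) = 0"
    using assms by (simp_all add: pos_add lamp_state_add mod_simps)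
qed

lemma eval_conj_word: "eval (conj_word l) = lamp (int l)"
  by (simp add: conj_word_def lamp_def int_mult_of_nat diff_conv_add_uminus add.assoc
      del: add_uminus_conv_diff)

text \<open>
  The relators say that \<open>a\<close> commutes with \<open>lamp l\<close> for \<open>l \<ge> 1\<close>. Conjugation by \<open>x\<^sup>i\<close>
  translates this to any two lamps.
\<close>

lemma lamp_commute: "lamp i + lamp j = lamp j + lamp i"
proof -
  have a_lamp: "a + lamp (int l) = lamp (int l) + a" if "l \<ge> 1" for l
  proof -
    have "comm_word [(Gen_a, True)] (conj_word l) \<in> wreath_relators d"
      using that by (auto simp: wreath_relators_def)
    from has_presentation_relator[OF presented this]
    have "a + lamp (int l) + (- a + - lamp (int l)) = 0"
      by (simp add: comm_word_def eval_conj_word add.assoc)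
    then show ?thesis by (simp add: add_eq_0_iff2 minus_add)
  qed
  have less: "lamp i + lamp j = lamp j + lamp i" if "i < j" for i j
  proof -
    let ?t = "int_mult i x"
    have "?t + a = lamp i + ?t" "?t + lamp (j - i) = lamp j + ?t"
      using int_mult_x_plus_lamp[of i 0] int_mult_x_plus_lamp[of i "j - i"] by (simp_all add: lamp_zero)
    moreover have "a + lamp (j - i) = lamp (j - i) + a" using a_lamp[of "nat (j - i)"] that by simp
    ultimately have "lamp i + lamp j + ?t = lamp j + lamp i + ?t" by (metis add.assoc)
    then show ?thesis by simp
  qed
  show ?thesis using less[of i j] less[of j i] by (cases i j rule: linorder_cases) auto
qed

lemma lamp_order: "sum_list (replicate d (lamp i)) = 0"
proof -
  have "sum_list (replicate n (lamp i)) = int_mult i x + sum_list (replicate n a) - int_mult i x" for n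
    by (induction n) (simp_all add: lamp_def diff_conv_add_uminus add.assoc del: add_uminus_conv_diff)
  moreover have "sum_list (replicate d a) = 0"
    using has_presentation_relator[OF presented, of "replicate d (Gen_a, True)"]
    by (simp add: wreath_relators_def)
  ultimately show ?thesis by simp
qed

section \<open>Products of norm elements of lamps\<close>

text \<open>
  The product of \<open>a - 1\<close> with the norm elements of the lamps in a list. The factors commute.
\<close>

primrec annihilator :: "int list \<Rightarrow> ('g \<Rightarrow>\<^sub>0 'k::comm_ring_1)" where
  "annihilator [] = group_ring_of a - 1"
| "annihilator (l # ls) = annihilator ls * norm_element d (lamp l)"

lemma lamp_times_norm_element_commute:
  "(group_ring_of (lamp i) - 1) * norm_element d (lamp j)
    = norm_element d (lamp j) * (group_ring_of (lamp i) - 1)"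
  by (rule norm_element_commute) (simp add: algebra_simps mult_single lamp_commute)

lemma lamp_times_annihilator_commute:
  "(group_ring_of (lamp i) - 1) * annihilator ls
    = (annihilator ls * (group_ring_of (lamp i) - 1) :: 'g \<Rightarrow>\<^sub>0 'k::comm_ring_1)"
proof (induction ls)
  case Nil
  then show ?case using lamp_commute[of i 0] by (simp add: algebra_simps mult_single lamp_zero)
next
  case (Cons l ls)
  let ?u = "group_ring_of (lamp i) - 1 :: 'g \<Rightarrow>\<^sub>0 'k"
  let ?N = "norm_element d (lamp l) :: 'g \<Rightarrow>\<^sub>0 'k"
  have "?u * annihilator (l # ls) = (?u * annihilator ls) * ?N"
    by (simp only: annihilator.simps mult.assoc)
  also have "\<dots> = annihilator ls * (?u * ?N)"
    by (subst Cons.IH) (simp only: mult.assoc)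
  also have "\<dots> = annihilator (l # ls) * ?u"
    by (simp only: lamp_times_norm_element_commute annihilator.simps mult.assoc)
  finally show ?case .
qed

lemma lamp_times_annihilator:
  assumes "l \<in> set ls"
  shows "(group_ring_of (lamp l) - 1) * annihilator ls = (0 :: 'g \<Rightarrow>\<^sub>0 'k::comm_ring_1)"
  using assms
proof (induction ls)
  case (Cons k ls)
  let ?u = "group_ring_of (lamp l) - 1 :: 'g \<Rightarrow>\<^sub>0 'k"
  have eq: "?u * annihilator (k # ls) = (?u * annihilator ls) * norm_element d (lamp k)"
    by (simp only: annihilator.simps mult.assoc)
  show ?case
  proof (cases "k = l")
    case True
    have "?u * annihilator (k # ls) = annihilator ls * (?u * norm_element d (lamp l))"
      by (subst eq, subst lamp_times_annihilator_commute) (simp only: True mult.assoc)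
    also have "\<dots> = 0"
      by (simp only: minus_one_times_norm_element[OF lamp_order] mult_zero_right)
    finally show ?thesis .
  next
    case False
    then have "?u * annihilator ls = 0" using Cons by simp
    then show ?thesis by (simp only: eq mult_zero_left)
  qed
qed simp

lemma norm_element_times_annihilator:
  "norm_element d a * annihilator ls = (0 :: 'g \<Rightarrow>\<^sub>0 'k::comm_ring_1)"
proof (induction ls)
  case Nil
  have "norm_element d a * (group_ring_of a - 1)
      = (group_ring_of a - 1) * (norm_element d a :: 'g \<Rightarrow>\<^sub>0 'k)"
    by (rule lamp_times_norm_element_commute[of 0 0, unfolded lamp_zero, symmetric])
  also have "\<dots> = 0"
    by (rule minus_one_times_norm_element[OF lamp_order[of 0, unfolded lamp_zero]])
  finally show ?case by (simp only: annihilator.simps)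
next
  case (Cons l ls)
  have "norm_element d a * annihilator (l # ls)
      = (norm_element d a * annihilator ls) * (norm_element d (lamp l) :: 'g \<Rightarrow>\<^sub>0 'k)"
    by (simp only: annihilator.simps mult.assoc)
  then show ?case by (simp only: Cons.IH mult_zero_left)
qed

text \<open>
  Multiplication by the norm element of a lamp \<open>l\<close> that the support of \<open>u\<close> does not touch spreads
  \<open>u\<close> over \<open>d\<close> disjoint translates. Only the trivial translate meets the unit, so the coefficient there does
  not change. The bound on the support keeps the induction going. The lamp \<open>0\<close> belongs to the
  factor \<open>a - 1\<close>, hence the exclusion of \<open>0\<close> from the list.
\<close>

lemma annihilator_coeff_and_supp:
  assumes "distinct ls" "0 \<notin> set ls"
  shows "coeff (annihilator ls :: 'g \<Rightarrow>\<^sub>0 'k::comm_ring_1) 0 = - 1"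
    and "g \<in> supp (annihilator ls :: 'g \<Rightarrow>\<^sub>0 'k) \<Longrightarrow>
      pos g = 0 \<and> (\<forall>i. i \<notin> insert 0 (set ls) \<longrightarrow> lamp_state g i = 0)"
  using assms
proof (induction ls arbitrary: g)
  case Nil
  case 1
  have "a \<noteq> 0" using lamp_state_a[of 0] lamp_state_zero[of 0] by force
  then show ?case by (simp add: coeff_group_ring_of_minus_one)
next
  case Nil
  case 2
  then have "g = a \<or> g = 0"
    by (auto simp: in_keys_iff lookup_minus lookup_single lookup_one when_def split: if_splits)
  then show ?case by (auto simp: pos_a lamp_state_a)
next
  case (Cons l ls)
  let ?u = "annihilator ls :: 'g \<Rightarrow>\<^sub>0 'k"
  let ?s = "\<lambda>m. sum_list (replicate m (lamp l))"
  note supp = Cons.IH(2)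
  {
    case 1
    \<comment> \<open>A nontrivial translate of the support that contained the unit would put lamp \<open>l\<close> in state \<open>m\<close>.\<close>
    have "coeff ?u (0 - ?s m) = 0" if "0 < m" "m < d" for m
    proof (rule ccontr)
      assume "coeff ?u (0 - ?s m) \<noteq> 0"
      then have g: "pos (0 - ?s m) = 0" "lamp_state (0 - ?s m) l = 0"
        using supp[of "0 - ?s m"] 1 by (auto simp: in_keys_iff)
      then have "lamp_state (0 - ?s m + ?s m) l = int m"
        using that by (subst lamp_state_add_lamps(1)) simp_all
      then show False using that by simp
    qed
    then have "(\<Sum>m<d. coeff ?u (0 - ?s m)) = (\<Sum>m\<in>{0}. coeff ?u (0 - ?s m))"
      using d_ge_2 by (intro sum.mono_neutral_right) auto
    also have "\<dots> = - 1" using Cons.IH(1) 1 by simp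
    finally show ?case by (simp add: coeff_times_norm_element)
  next
    case 2
    then have "(\<Sum>m<d. coeff ?u (g - ?s m)) \<noteq> 0"
      by (simp add: in_keys_iff coeff_times_norm_element)
    then obtain m where m: "g - ?s m \<in> supp ?u"
      by (metis (mono_tags, lifting) in_keys_iff sum.neutral)
    have h: "pos (g - ?s m) = 0" "\<And>i. i \<notin> insert 0 (set ls) \<Longrightarrow> lamp_state (g - ?s m) i = 0"
      using supp[OF m] 2 by auto
    show ?case
      using lamp_state_add_lamps[OF h(1), of m l] h(2) by auto
  }
qed

text \<open>
  The elements killed by every sufficiently long product. Quantifying over all lists that contain
  a finite set \<open>F\<close> makes closure under addition a matter of taking unions.
\<close>

definition eventually_annihilated :: "('g \<Rightarrow>\<^sub>0 'k::comm_ring_1) set"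
  where "eventually_annihilated =
    {u. \<exists>F. finite F \<and> 0 \<notin> F \<and> (\<forall>ls. F \<subseteq> set ls \<longrightarrow> u * annihilator ls = 0)}"

lemma eventually_annihilatedI:
  assumes "finite F" "0 \<notin> F" "\<And>ls. F \<subseteq> set ls \<Longrightarrow> u * annihilator ls = 0"
  shows "u \<in> eventually_annihilated"
  using assms unfolding eventually_annihilated_def by blast

lemma left_ideal_eventually_annihilated:
  "left_ideal (eventually_annihilated :: ('g \<Rightarrow>\<^sub>0 'k::comm_ring_1) set)"
  unfolding left_ideal_def
proof (intro conjI ballI allI)
  show "0 \<in> (eventually_annihilated :: ('g \<Rightarrow>\<^sub>0 'k) set)"
    by (rule eventually_annihilatedI[of "{}"]) simp_all
next
  fix u v :: "'g \<Rightarrow>\<^sub>0 'k"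
  assume "u \<in> eventually_annihilated" "v \<in> eventually_annihilated"
  then obtain E F where
    "finite E" "0 \<notin> E" "\<And>ls. E \<subseteq> set ls \<Longrightarrow> u * annihilator ls = 0"
    "finite F" "0 \<notin> F" "\<And>ls. F \<subseteq> set ls \<Longrightarrow> v * annihilator ls = 0"
    unfolding eventually_annihilated_def by blast
  then show "u + v \<in> eventually_annihilated"
    by (intro eventually_annihilatedI[of "E \<union> F"]) (simp_all add: distrib_right)
next
  fix r u :: "'g \<Rightarrow>\<^sub>0 'k"
  assume "u \<in> eventually_annihilated"
  then obtain F where "finite F" "0 \<notin> F" "\<And>ls. F \<subseteq> set ls \<Longrightarrow> u * annihilator ls = 0"
    unfolding eventually_annihilated_def by blast
  then show "r * u \<in> eventually_annihilated"
    by (intro eventually_annihilatedI[of F]) (simp_all add: mult.assoc)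
qed

lemma left_zerodivisor_eventually_annihilated:
  fixes u :: "'g \<Rightarrow>\<^sub>0 'k::comm_ring_1"
  assumes "u \<in> eventually_annihilated"
  shows "left_zerodivisor u"
proof -
  obtain F where F: "finite F" "0 \<notin> F" "\<And>ls. F \<subseteq> set ls \<Longrightarrow> u * annihilator ls = 0"
    using assms unfolding eventually_annihilated_def by blast
  let ?ls = "sorted_list_of_set F"
  have "coeff (annihilator ?ls :: 'g \<Rightarrow>\<^sub>0 'k) 0 = - 1"
    using F by (intro annihilator_coeff_and_supp) simp_all
  then have "(annihilator ?ls :: 'g \<Rightarrow>\<^sub>0 'k) \<noteq> 0" by auto
  moreover have "u * annihilator ?ls = 0" using F by simp
  ultimately show ?thesis unfolding left_zerodivisor_def by blast
qed

lemma fox_deriv_a_conj_word: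
  "fox_deriv (case_wreath_gen a x) Gen_a (conj_word l)
    = (group_ring_of (int_mult (int l) x) :: 'g \<Rightarrow>\<^sub>0 'k::comm_ring_1)"
proof -
  have "fox_deriv (case_wreath_gen a x) Gen_a (replicate n (Gen_x, True)) = (0 :: 'g \<Rightarrow>\<^sub>0 'k)" for n
    by (induction n) simp_all
  then show ?thesis
    by (simp add: conj_word_def fox_deriv_append fox_deriv_inv_word int_mult_of_nat)
qed

text \<open>
  For the commutator of \<open>a\<close> with its conjugate by \<open>x\<^sup>l\<close>, moving \<open>x\<^sup>l\<close> to the left of \<open>a - 1\<close> shows that
  the norm elements of the two lamps \<open>l\<close> and \<open>- l\<close> together kill the derivative. For \<open>a\<^sup>d\<close>
  the derivative is the norm element of \<open>a\<close>, and the factor \<open>a - 1\<close> kills it.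
\<close>

lemma fox_deriv_a_relator:
  assumes "r \<in> wreath_relators d"
  shows "fox_deriv (case_wreath_gen a x) Gen_a r
    \<in> (eventually_annihilated :: ('g \<Rightarrow>\<^sub>0 'k::comm_ring_1) set)" (is "?D r \<in> _")
proof -
  consider "r = replicate d (Gen_a, True)"
    | l where "l \<ge> 1" "r = comm_word [(Gen_a, True)] (conj_word l)"
    using assms unfolding wreath_relators_def by blast
  then show ?thesis
  proof cases
    case 1
    have "?D r = norm_element d a"
      by (simp add: 1 fox_deriv_replicate norm_element_def)
    then show ?thesis
      by (intro eventually_annihilatedI[of "{}"]) (simp_all add: norm_element_times_annihilator)
  next
    case 2
    let ?x = "group_ring_of (int_mult (int l) x) :: 'g \<Rightarrow>\<^sub>0 'k"
    have "?D r = (group_ring_of a - 1) * ?x - (group_ring_of (lamp (int l)) - 1)"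
      unfolding 2 using lamp_commute[of 0 "int l"]
      by (subst fox_deriv_comm_word) (simp_all add: eval_conj_word fox_deriv_a_conj_word lamp_zero)
    also have "(group_ring_of a - 1) * ?x = ?x * (group_ring_of (lamp (- int l)) - 1)"
      using int_mult_x_plus_lamp[of "int l" "- int l"] by (simp add: algebra_simps mult_single lamp_zero)
    finally have D: "?D r = ?x * (group_ring_of (lamp (- int l)) - 1) - (group_ring_of (lamp (int l)) - 1)" .
    show ?thesis
    proof (rule eventually_annihilatedI[of "{int l, - int l}"])
      fix ls :: "int list"
      assume ls: "{int l, - int l} \<subseteq> set ls"
      show "?D r * annihilator ls = 0"
        unfolding D left_diff_distrib[of "?x * _"] mult.assoc[of ?x]
        using ls by (simp only: lamp_times_annihilator insert_subset mult_zero_right diff_self)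
    qed (use 2 in auto)
  qed
qed

lemma left_zerodivisor_of_common_multiple:
  fixes u v :: "'g \<Rightarrow>\<^sub>0 'k::comm_ring_1"
  assumes "u * (group_ring_of a - 1) = v * (group_ring_of x - 1)"
  shows "left_zerodivisor u"
proof -
  let ?I = "eventually_annihilated :: ('g \<Rightarrow>\<^sub>0 'k) set"
  obtain T :: "('g \<Rightarrow>\<^sub>0 'k) \<Rightarrow> ('g \<Rightarrow>\<^sub>0 'k)" where T:
    "\<And>y u. T (u * (group_ring_of (case_wreath_gen a x y) - 1)) - u * of_bool (y = Gen_a) \<in> ?I"
    using fox_deriv_extends_to_group_ring[OF presented left_ideal_eventually_annihilated fox_deriv_a_relator]
    by blast
  let ?t = "T (u * (group_ring_of a - 1))"
  have "?t \<in> ?I" using T[of v Gen_x] unfolding assms by simp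
  moreover have "?t - u \<in> ?I" using T[of u Gen_a] by simp
  ultimately have "?t - (?t - u) \<in> ?I" by (rule left_ideal_diff[OF left_ideal_eventually_annihilated])
  then have "u \<in> ?I" by simp
  then show ?thesis by (rule left_zerodivisor_eventually_annihilated)
qed

lemma not_ore_condition: "\<not> ore_condition TYPE('g \<Rightarrow>\<^sub>0 'k::comm_ring_1)"
proof
  assume ore: "ore_condition TYPE('g \<Rightarrow>\<^sub>0 'k)"
  have "non_zerodivisor (group_ring_of (- x) - 1 :: 'g \<Rightarrow>\<^sub>0 'k)"
    by (rule non_zerodivisor_group_ring_of_minus_one[of pos]) (simp_all add: pos_add pos_minus pos_x)
  then obtain p q :: "'g \<Rightarrow>\<^sub>0 'k" where p: "non_zerodivisor p"
    and "(group_ring_of (- x) - 1) * q = (group_ring_of (- a) - 1) * p"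
    using ore unfolding ore_condition_def by blast
  then have "star p * (group_ring_of a - 1) = star q * (group_ring_of x - 1)"
    using star_mult[of "group_ring_of (- x) - 1" q] star_mult[of "group_ring_of (- a) - 1" p]
    by (simp add: star_diff)
  then obtain c where c: "c \<noteq> 0" "star p * c = 0"
    using left_zerodivisor_of_common_multiple unfolding left_zerodivisor_def by blast
  have "star c * p = 0" using star_mult[of "star p" c] c by simp
  then have "star c = 0" using p unfolding non_zerodivisor_def by blast
  then show False using c star_star[of c] by simp
qed

end

theorem theorem11:
  fixes d :: nat and a x :: "'g::group_add"
  assumes "d \<ge> 2"
    and "wreath_presentation d a x"
  shows "(\<forall>u v :: 'g \<Rightarrow>\<^sub>0 'k::comm_ring_1.
            u * (group_ring_of a - 1) = v * (group_ring_of x - 1) \<longrightarrow> left_zerodivisor u)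
         \<and> \<not> ore_condition TYPE('g \<Rightarrow>\<^sub>0 'k)"
proof -
  interpret lamplighter d a x using assms by unfold_locales
  show ?thesis using left_zerodivisor_of_common_multiple not_ore_condition by blast
qed

end
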